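(* Let $F$ be a distribution function on $[0,1]$, let $X_1,X_2,\ldots$ be i.i.d. with distribution function $F$, and let $0<s<1$. Then, as $n\to\infty$, $$S_n(s)\ \xrightarrow{a.s.}\ S_\infty(s,F):=\sup_{0<x<1}K_s(F(x),x).$$
   Context: $\mathbb{F}_n(x)=n^{-1}\sum_{i=1}^n1\{X_i\le x\}$ is the empirical distribution function and $X_{(1)}\le\cdots\le X_{(n)}$ are the order statistics of $X_1,\ldots,X_n$. For $0<s<1$, $u\in[0,1]$, $v\in(0,1)$, $$K_s(u,v)=\frac{1}{s(1-s)}\{1-u^sv^{1-s}-(1-u)^s(1-v)^{1-s}\},$$ and $S_n(s)=\sup_{X_{(1)}\le x<X_{(n)}}K_s(\mathbb{F}_n(x),x)$.
   Formalization: Added assumption: F has no atom at the lower endpoint a of its support unless a=0, nor at the upper endpoint b unless b=1; without it the claim fails, e.g. for F with mass 1/2 at each of 1/2 and 3/5 and s=1/2. *)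

theory Defs
  imports "HOL-Probability.Probability"
begin

definition unit_distribution_function :: "(real \<Rightarrow> real) \<Rightarrow> bool" where
  "unit_distribution_function F \<longleftrightarrow>
     mono F \<and> (\<forall>x. continuous (at_right x) F) \<and> (\<forall>x<0. F x = 0) \<and> (\<forall>x\<ge>1. F x = 1)"

(* Let a and b be the lower and upper endpoints of the support of F.  The condition says that F
   has no atom at a unless a = 0, and no atom at b unless b = 1.  It always holds if F is continuous,
   and it leaves atoms strictly between a and b unrestricted.
   Some such condition is needed for S_n to converge to S_inf.  S_n only takes into account points in
   [X_(1), X_(n)), and S_inf also those in (0,a) and [b,1), where F is 0 and 1.  If F jumps at a > 0
   or at b < 1, the values of K_s there need not be approached from within [a,b).  For example, if F
   puts mass 1/2 on each of 1/2 and 3/5, then for s = 1/2 the limit of S_n is K_s(1/2, 3/5) < 0.03,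
   whereas S_inf >= K_s(0, 0.49) > 1.  If F is a point mass, the range [X_(1), X_(n)) is always
   empty. *)
definition no_atom_at_inner_endpoints :: "(real \<Rightarrow> real) \<Rightarrow> bool" where
  "no_atom_at_inner_endpoints F \<longleftrightarrow>
     (\<forall>a>0. (\<forall>y<a. F y = 0) \<longrightarrow> isCont F a) \<and>
     (\<forall>b<1. (\<forall>y>b. F y = 1) \<longrightarrow> isCont F b)"

(* Sample points are indexed from 0: x 0, ..., x (n - 1) stand for X_1, ..., X_n. *)
definition empirical_df :: "(nat \<Rightarrow> real) \<Rightarrow> nat \<Rightarrow> real \<Rightarrow> real" where
  "empirical_df x n t = (\<Sum>i<n. indicat_real {..t} (x i)) / real n"

(* The k-th smallest of x 0, ..., x (n - 1), for 1 <= k <= n. *)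
definition order_statistic :: "(nat \<Rightarrow> real) \<Rightarrow> nat \<Rightarrow> nat \<Rightarrow> real" where
  "order_statistic x n k = sort (map x [0..<n]) ! (k - 1)"

(* Since 0 powr r = 0, the boundary values 0^s = 0^(1-s) = 0 are the intended ones for 0 < s < 1.
   In particular, K s u 0 is the continuous extension of K_s to v = 0, which S_n uses only when
   X_(1) = 0. *)
definition K :: "real \<Rightarrow> real \<Rightarrow> real \<Rightarrow> real" where
  "K s u v = 1 / (s * (1 - s)) *
     (1 - u powr s * v powr (1 - s) - (1 - u) powr s * (1 - v) powr (1 - s))"

(* The range of t is empty if n = 0 or all sample points coincide; S_n is then an unspecified real. *)
definition S_n :: "real \<Rightarrow> (nat \<Rightarrow> real) \<Rightarrow> nat \<Rightarrow> real" where
  "S_n s x n =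
     (SUP t\<in>{order_statistic x n 1..<order_statistic x n n}. K s (empirical_df x n t) t)"

definition S_inf :: "real \<Rightarrow> (real \<Rightarrow> real) \<Rightarrow> real" where
  "S_inf s F = (SUP x\<in>{0<..<1}. K s (F x) x)"

end

theory Submission
  imports Defs
begin

text \<open>
  By the Glivenko-Cantelli theorem, here obtained from Hoeffding's inequality and the Borel-Cantelli
  lemma, the empirical distribution functions converge uniformly to \<open>F\<close> almost surely.  Since
  \<open>K s\<close> is uniformly continuous on the unit square and \<open>[X\<^sub>(\<^sub>1\<^sub>), X\<^sub>(\<^sub>n\<^sub>))\<close> is exactly the set where the
  empirical distribution function lies strictly between 0 and 1, every \<open>t\<close> with \<open>0 < F t < 1\<close>
  eventually enters the range of the supremum.  It remains to see that \<open>S_inf\<close> is already the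
  supremum over such \<open>t\<close>, which is where the condition on the endpoints of the support enters.
\<close>

section \<open>Almost sure uniform convergence of the empirical distribution function\<close>

text \<open>For each fixed deviation the Hoeffding tails are summable in \<open>n\<close>, so
  Borel-Cantelli excludes infinitely many violations; the deviations \<open>1 / (k + 1)\<close>
  suffice and are countable. The set \<open>A\<close> is kept general because both closed and open
  half-lines are needed below.\<close>

lemma (in prob_space) AE_frequency_tendsto:
  fixes X :: "nat \<Rightarrow> 'a \<Rightarrow> real"
  assumes indep: "indep_vars (\<lambda>_. borel) X UNIV"
    and A [measurable]: "A \<in> sets borel"
    and p: "\<And>i. measure (distr M borel (X i)) A = p"
  shows "AE \<omega> in M. (\<lambda>n. (\<Sum>i<n. indicat_real A (X i \<omega>)) / real n) \<longlonglongrightarrow> p"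
proof -
  have X [measurable]: "random_variable borel (X i)" for i
    using indep unfolding indep_vars_def by blast
  define S where "S = (\<lambda>n \<omega>. \<Sum>i<n. indicat_real A (X i \<omega>))"
  have [measurable]: "random_variable borel (S n)" for n
    unfolding S_def by measurable
  have E: "expectation (\<lambda>\<omega>. indicat_real A (X i \<omega>)) = p" for i
  proof -
    have "expectation (\<lambda>\<omega>. indicat_real A (X i \<omega>)) = (\<integral>x. indicat_real A x \<partial>distr M borel (X i))"
      by (intro integral_distr [symmetric]) auto
    then show ?thesis using p[of i] by simp
  qed
  have tail: "prob {\<omega>\<in>space M. \<bar>S n \<omega> - real n * p\<bar> \<ge> real n * e} \<le> 2 * exp (- 2 * e\<^sup>2) ^ n"
    if e: "e > 0" for n e
  proof (cases "n = 0")
    case True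
    then show ?thesis using prob_le_1[of "space M"] by (simp add: prob_space)
  next
    case False
    interpret H: Hoeffding_ineq M "{..<n}" "\<lambda>i \<omega>. indicat_real A (X i \<omega>)" "\<lambda>_. 0" "\<lambda>_. 1"
      "\<Sum>i<n. expectation (\<lambda>\<omega>. indicat_real A (X i \<omega>))"
    proof unfold_locales
      show "indep_vars (\<lambda>_. borel) (\<lambda>i \<omega>. indicat_real A (X i \<omega>)) {..<n}"
        by (rule indep_vars_compose2[OF indep_vars_subset[OF indep]]) auto
    qed (auto simp: indicator_def)
    have "prob {\<omega>\<in>space M. \<bar>S n \<omega> - real n * p\<bar> \<ge> real n * e}
      \<le> 2 * exp (- 2 * (real n * e)\<^sup>2 / real n)"
      using H.Hoeffding_ineq_abs_ge[of "real n * e"] e False by (simp add: S_def E)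
    \<comment> \<open>With the factor \<open>n\<close> pulled out of the exponent, the bound is a
      geometric sequence of ratio \<open>exp (- 2 * e^2) < 1\<close>.\<close>
    also have "- 2 * (real n * e)\<^sup>2 / real n = real n * (- 2 * e\<^sup>2)"
      using False by (simp add: power2_eq_square)
    finally show ?thesis by (simp only: exp_of_nat_mult)
  qed
  have "AE \<omega> in M. \<forall>\<^sub>F n in sequentially. \<bar>S n \<omega> - real n * p\<bar> < real n * e" if e: "e > 0" for e
  proof -
    have "summable (\<lambda>n. 2 * exp (- 2 * e\<^sup>2) ^ n)"
      using e by (intro summable_mult summable_geometric) simp
    then have "summable (\<lambda>n. prob {\<omega>\<in>space M. \<bar>S n \<omega> - real n * p\<bar> \<ge> real n * e})"
      by (rule summable_comparison_test') (use tail[OF e] in simp)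
    from borel_cantelli_AE1[OF _ _ this]
    have "AE \<omega> in M. \<forall>\<^sub>F n in sequentially.
        \<omega> \<in> space M - {\<omega>\<in>space M. \<bar>S n \<omega> - real n * p\<bar> \<ge> real n * e}"
      by (simp add: emeasure_eq_measure)
    then show ?thesis
      by (rule AE_mp) (auto elim!: eventually_mono intro!: AE_I2)
  qed
  then have "AE \<omega> in M. \<forall>k. \<forall>\<^sub>F n in sequentially. \<bar>S n \<omega> - real n * p\<bar> < real n * inverse (real (Suc k))"
    by (subst AE_all_countable) simp
  then show ?thesis
  proof eventually_elim
    case (elim \<omega>)
    show ?case
    proof (rule tendstoI)
      fix e :: real assume "e > 0"
      then obtain k where k: "inverse (real (Suc k)) < e" using reals_Archimedean by blast
      from elim have "\<forall>\<^sub>F n in sequentially. \<bar>S n \<omega> - real n * p\<bar> < real n * inverse (real (Suc k))" ..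
      moreover have "\<forall>\<^sub>F n::nat in sequentially. n > 0" by (rule eventually_gt_at_top)
      ultimately show "\<forall>\<^sub>F n in sequentially. dist ((\<Sum>i<n. indicat_real A (X i \<omega>)) / real n) p < e"
      proof eventually_elim
        case (elim n)
        have "\<bar>S n \<omega> / real n - p\<bar> = \<bar>S n \<omega> - real n * p\<bar> / real n"
          using elim by (simp add: abs_div_pos diff_divide_distrib)
        also have "\<dots> < e" using elim k
          by (metis less_trans mult.commute of_nat_0_less_iff pos_divide_less_eq)
        finally show ?case by (simp add: S_def dist_real_def)
      qed
    qed
  qed
qed

section \<open>Quantile grids and the Glivenko-Cantelli theorem\<close>

text \<open>The generalized inverse \<open>Inf {x. r \<le> cdf N x}\<close> works because a
  distribution function is monotone and right-continuous, so the infimum is attained.\<close>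

lemma real_distribution_quantile:
  assumes "real_distribution N"
  obtains q where "\<And>r x. 0 < r \<Longrightarrow> r < 1 \<Longrightarrow> r \<le> cdf N x \<longleftrightarrow> q r \<le> x"
proof -
  interpret cdf_distribution N using assms by (simp add: cdf_distribution_def)
  show thesis by (rule that[of I]) (rule pseudoinverse)
qed

lemma empirical_df_nonneg: "0 \<le> empirical_df x n t"
  by (simp add: empirical_df_def sum_nonneg)

lemma empirical_df_le_1: "empirical_df x n t \<le> 1"
proof -
  have "(\<Sum>i<n. indicat_real {..t} (x i)) \<le> (\<Sum>i<n. 1)"
    by (intro sum_mono) (simp add: indicator_def)
  then show ?thesis by (cases "n = 0") (simp_all add: empirical_df_def)
qed

text \<open>The deterministic half of Glivenko-Cantelli. The quantiles of \<open>j / m\<close> cut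
  the line into pieces on whose interiors the cdf varies by at most \<open>1 / m\<close>;
  monotonicity carries the finitely many grid estimates to all \<open>t\<close>. Controlling left
  limits as well as values at the grid points takes care of atoms.\<close>

lemma uniform_limit_empirical_df:
  assumes N: "real_distribution N"
    and q: "\<And>r t. 0 < r \<Longrightarrow> r < 1 \<Longrightarrow> r \<le> cdf N t \<longleftrightarrow> q r \<le> t"
    and lim: "\<And>r. r \<in> \<rat> \<Longrightarrow> (\<lambda>n. empirical_df x n (q r)) \<longlonglongrightarrow> cdf N (q r)"
    and lim': "\<And>r. r \<in> \<rat> \<Longrightarrow>
      (\<lambda>n. (\<Sum>i<n. indicat_real {..<q r} (x i)) / real n) \<longlonglongrightarrow> measure N {..<q r}"
  shows "uniform_limit UNIV (empirical_df x) (cdf N) sequentially"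
proof (rule uniform_limitI)
  interpret real_distribution N by (rule N)
  fix e :: real assume "e > 0"
  \<comment> \<open>\<open>L n\<close> is the left limit of the empirical distribution function, as
    \<open>measure N {..<t}\<close> is that of the cdf.\<close>
  define L where "L n t = (\<Sum>i<n. indicat_real {..<t} (x i)) / real n" for n t
  obtain k :: nat where "inverse (real (Suc k)) < e / 2"
    using reals_Archimedean[of "e / 2"] \<open>e > 0\<close> by auto
  \<comment> \<open>Half of \<open>e\<close> is spent on the mesh \<open>1 / m\<close>, the other
    half on the convergence at the grid points.\<close>
  then obtain m :: nat where m: "m > 0" "1 / real m < e / 2"
    by (metis inverse_eq_divide zero_less_Suc)
  have left: "measure N {..<q r} \<le> r" if r: "0 < r" "r < 1" for r
  proof (rule tendsto_upperbound[OF cdf_at_left])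
    have "cdf N t \<le> r" if "t < q r" for t using q[OF r, of t] that by simp
    then show "\<forall>\<^sub>F t in at_left (q r). cdf N t \<le> r"
      by (auto simp: eventually_at_filter)
  qed simp
  have L_ge: "empirical_df x n t \<le> L n u" if "t < u" for n t u
    using that unfolding empirical_df_def L_def
    by (intro divide_right_mono sum_mono) (auto simp: indicator_def)
  have mono: "empirical_df x n t \<le> empirical_df x n u" if "t \<le> u" for n t u
    using that unfolding empirical_df_def
    by (intro divide_right_mono sum_mono) (auto simp: indicator_def)
  have "\<forall>\<^sub>F n in sequentially. \<forall>j\<in>{1..<m}.
      dist (empirical_df x n (q (j / m))) (cdf N (q (j / m))) < e / 2 \<and>
      dist (L n (q (j / m))) (measure N {..<q (j / m)}) < e / 2"
    unfolding L_def using \<open>e > 0\<close>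
    by (intro eventually_ball_finite ballI eventually_conj tendstoD[OF lim] tendstoD[OF lim']) auto
  then show "\<forall>\<^sub>F n in sequentially. \<forall>t\<in>UNIV. dist (empirical_df x n t) (cdf N t) < e"
  proof eventually_elim
    case (elim n)
    have grid: "empirical_df x n (q (j / m)) > j / m - e / 2" "L n (q (j / m)) < j / m + e / 2"
      if "1 \<le> j" "j < m" for j :: nat
    proof -
      have j: "0 < j / real m" "j / real m < 1" using that m by auto
      from elim that have "dist (empirical_df x n (q (j / m))) (cdf N (q (j / m))) < e / 2"
        "dist (L n (q (j / m))) (measure N {..<q (j / m)}) < e / 2" by auto
      moreover have "j / m \<le> cdf N (q (j / m))" using q[OF j] by simp
      ultimately show "empirical_df x n (q (j / m)) > j / m - e / 2"
        "L n (q (j / m)) < j / m + e / 2"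
        using left[OF j] unfolding dist_real_def by linarith+
    qed
    show ?case
    proof
      fix t
      have c: "0 \<le> cdf N t" "cdf N t \<le> 1" by (simp_all add: cdf_nonneg cdf_bounded_prob)
      have "cdf N t - e < empirical_df x n t"
      proof (rule ccontr)
        assume *: "\<not> ?thesis"
        \<comment> \<open>The largest integer strictly below \<open>m * cdf N t\<close>; strictness
          gives \<open>j < m\<close> even if \<open>cdf N t = 1\<close>. The negated claim forces
          \<open>cdf N t \<ge> e > 1 / m\<close>, hence \<open>1 \<le> j\<close>.\<close>
        define j where "j = nat (\<lceil>m * cdf N t\<rceil> - 1)"
        have "m * cdf N t > 1"
        proof -
          have "cdf N t > 1 / m"
            using * m \<open>e > 0\<close> empirical_df_nonneg[of x n t] by linarith
          then show ?thesis using m by (simp add: field_simps)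
        qed
        then have j: "j < m * cdf N t" "m * cdf N t \<le> j + 1" "1 \<le> j"
          unfolding j_def by linarith+
        have "m * cdf N t \<le> m" using c by (simp add: mult_left_le)
        then have jm: "j < m" using j by linarith
        have "j / m \<le> cdf N t" using j m by (simp add: field_simps)
        then have "q (j / m) \<le> t" using q[of "j / m" t] j jm by simp
        then have "j / m - e / 2 < empirical_df x n t"
          using mono[of "q (j / m)" t n] grid(1)[of j] j jm by linarith
        moreover have "cdf N t \<le> j / m + 1 / m" using j m by (simp add: field_simps)
        ultimately show False using * m by linarith
      qed
      moreover have "empirical_df x n t < cdf N t + e"
      proof (rule ccontr)
        assume *: "\<not> ?thesis"
        \<comment> \<open>The smallest integer strictly above \<open>m * cdf N t\<close>, so that
          \<open>t\<close> lies strictly left of \<open>q (j / m)\<close> and \<open>L\<close>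
          applies there. The negated claim forces \<open>cdf N t \<le> 1 - e\<close>, hence
          \<open>j < m\<close>.\<close>
        define j where "j = nat (\<lfloor>m * cdf N t\<rfloor> + 1)"
        have "0 \<le> m * cdf N t" using c by simp
        then have j: "m * cdf N t < j" "j \<le> m * cdf N t + 1" "1 \<le> j"
          unfolding j_def by linarith+
        have jN: "j / m \<le> cdf N t + 1 / m" "cdf N t < j / m" using j m by (simp_all add: field_simps)
        then have "j / m < 1"
          using * m \<open>e > 0\<close> empirical_df_le_1[of x n t] by linarith
        then have jm: "j < m" using m by simp
        then have "t < q (j / m)" using q[of "j / m" t] j jN by simp
        then have "empirical_df x n t < j / m + e / 2"
          using L_ge[of t "q (j / m)" n] grid(2)[of j] j jm by linarith
        then show False using * m jN by linarith
      qed
      ultimately show "dist (empirical_df x n t) (cdf N t) < e" by (simp add: dist_real_def abs_less_iff)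
    qed
  qed
qed

text \<open>All grid levels \<open>j / m\<close> are rational, so a single null set covers every
  mesh at once.\<close>

theorem (in prob_space) Glivenko_Cantelli:
  assumes indep: "indep_vars (\<lambda>_. borel) X UNIV"
    and cdf: "\<And>i. cdf (distr M borel (X i)) = F"
  shows "AE \<omega> in M. uniform_limit UNIV (empirical_df (\<lambda>i. X i \<omega>)) F sequentially"
proof -
  define N where "N = distr M borel (X 0)"
  have "random_variable borel (X i)" for i
    using indep unfolding indep_vars_def by blast
  then have rd: "real_distribution (distr M borel (X i))" for i by simp
  then have N: "real_distribution N" unfolding N_def .
  have distr: "distr M borel (X i) = N" for i
    unfolding N_def by (rule cdf_unique[OF rd rd]) (simp add: cdf)
  obtain q where q: "\<And>r t. 0 < r \<Longrightarrow> r < 1 \<Longrightarrow> r \<le> cdf N t \<longleftrightarrow> q r \<le> t"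
    using real_distribution_quantile[OF N] by metis
  have "AE \<omega> in M. \<forall>r\<in>\<rat>. (\<lambda>n. empirical_df (\<lambda>i. X i \<omega>) n (q r)) \<longlonglongrightarrow> cdf N (q r)"
    unfolding empirical_df_def cdf_def
    by (intro AE_ball_countable' countable_rat AE_frequency_tendsto[OF indep]) (simp_all add: distr)
  moreover have "AE \<omega> in M. \<forall>r\<in>\<rat>.
      (\<lambda>n. (\<Sum>i<n. indicat_real {..<q r} (X i \<omega>)) / real n) \<longlonglongrightarrow> measure N {..<q r}"
    by (intro AE_ball_countable' countable_rat AE_frequency_tendsto[OF indep]) (simp_all add: distr)
  ultimately show ?thesis
  proof eventually_elim
    case (elim \<omega>)
    have "uniform_limit UNIV (empirical_df (\<lambda>i. X i \<omega>)) (cdf N) sequentially"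
      using elim by (intro uniform_limit_empirical_df[OF N q]) auto
    then show ?case using cdf distr by simp
  qed
qed

section \<open>The divergence and its supremum\<close>

text \<open>Both exponents are positive, so the powers stay continuous at base 0 and the closed
  square, which is compact, can serve as domain.\<close>

lemma continuous_on_K:
  assumes "0 < s" "s < 1"
  shows "continuous_on ({0..1} \<times> {0..1}) (\<lambda>z. K s (fst z) (snd z))"
  unfolding K_def using assms
  by (intro continuous_intros continuous_on_powr') auto

lemma K_le:
  assumes "0 < s" "s < 1"
  shows "K s u v \<le> 1 / (s * (1 - s))"
proof -
  have "1 - u powr s * v powr (1 - s) - (1 - u) powr s * (1 - v) powr (1 - s) \<le> 1"
    by (smt (verit) mult_nonneg_nonneg powr_ge_zero)
  then show ?thesis unfolding K_def using assms by (intro mult_left_le) auto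
qed

text \<open>For \<open>u = 0\<close> the braces reduce to \<open>1 - (1 - v) powr (1 - s)\<close>,
  and for \<open>u = 1\<close>, in the next lemma, to \<open>1 - v powr (1 - s)\<close>.\<close>

lemma K_0_mono:
  assumes "0 < s" "s < 1" "v \<le> w" "w \<le> 1"
  shows "K s 0 v \<le> K s 0 w"
  unfolding K_def using assms
  by (intro mult_left_mono) (auto intro!: powr_mono2)

lemma K_1_antimono:
  assumes "0 < s" "s < 1" "0 \<le> v" "v \<le> w"
  shows "K s 1 w \<le> K s 1 v"
  unfolding K_def using assms
  by (intro mult_left_mono) (auto intro!: powr_mono2)

lemma tendsto_K:
  assumes s: "0 < s" "s < 1"
    and lim: "(f \<longlongrightarrow> u) G" "(g \<longlongrightarrow> v) G"
    and uv: "u \<in> {0..1}" "v \<in> {0..1}"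
    and ev: "\<forall>\<^sub>F t in G. f t \<in> {0..1} \<and> g t \<in> {0..1}"
  shows "((\<lambda>t. K s (f t) (g t)) \<longlongrightarrow> K s u v) G"
proof -
  have "((\<lambda>t. K s (fst (f t, g t)) (snd (f t, g t))) \<longlongrightarrow> K s (fst (u, v)) (snd (u, v))) G"
    by (rule continuous_on_tendsto_compose[OF continuous_on_K[OF s] tendsto_Pair[OF lim]])
       (use uv ev in \<open>auto elim: eventually_mono\<close>)
  then show ?thesis by simp
qed

section \<open>The sample range in terms of the empirical distribution function\<close>

lemma empirical_df_pos_iff:
  assumes "n > 0"
  shows "0 < empirical_df x n t \<longleftrightarrow> (\<exists>i<n. x i \<le> t)"
proof -
  have "0 < empirical_df x n t \<longleftrightarrow> (\<Sum>i<n. indicat_real {..t} (x i)) \<noteq> 0"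
    using assms empirical_df_nonneg[of x n t] unfolding less_le
    by (simp add: empirical_df_def eq_commute[of 0])
  also have "\<dots> \<longleftrightarrow> (\<exists>i<n. x i \<le> t)"
    by (subst sum_nonneg_eq_0_iff) (auto simp: indicator_def)
  finally show ?thesis .
qed

lemma empirical_df_less_1_iff:
  assumes "n > 0"
  shows "empirical_df x n t < 1 \<longleftrightarrow> (\<exists>i<n. t < x i)"
proof -
  have "1 - empirical_df x n t = (\<Sum>i<n. 1 - indicat_real {..t} (x i)) / n"
    using assms by (simp add: empirical_df_def sum_subtractf diff_divide_distrib)
  moreover have "(\<Sum>i<n. 1 - indicat_real {..t} (x i)) \<ge> 0"
    by (intro sum_nonneg) (simp add: indicator_def)
  ultimately have "empirical_df x n t < 1 \<longleftrightarrow> (\<Sum>i<n. 1 - indicat_real {..t} (x i)) \<noteq> 0"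
    using assms by (smt (verit) divide_eq_0_iff divide_nonneg_nonneg of_nat_0_eq_iff of_nat_0_le_iff less_numeral_extra(3))
  also have "\<dots> \<longleftrightarrow> (\<exists>i<n. t < x i)"
    by (subst sum_nonneg_eq_0_iff) (auto simp: indicator_def not_le)
  finally show ?thesis .
qed

lemma order_statistic_first_le_iff:
  assumes "n > 0"
  shows "order_statistic x n 1 \<le> t \<longleftrightarrow> (\<exists>i<n. x i \<le> t)"
proof -
  let ?l = "sort (map x [0..<n])"
  have "?l ! 0 \<le> t \<longleftrightarrow> (\<exists>y\<in>set ?l. y \<le> t)"
  proof
    assume "\<exists>y\<in>set ?l. y \<le> t"
    then obtain j where "j < n" "?l ! j \<le> t"
      by (metis in_set_conv_nth length_map length_sort length_upt diff_zero)
    then show "?l ! 0 \<le> t"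
      using sorted_nth_mono[of ?l 0 j] by simp
  qed (use assms nth_mem[of 0 ?l] in auto)
  also have "\<dots> \<longleftrightarrow> (\<exists>i<n. x i \<le> t)" by auto
  finally show ?thesis by (simp add: order_statistic_def)
qed

lemma less_order_statistic_last_iff:
  assumes "n > 0"
  shows "t < order_statistic x n n \<longleftrightarrow> (\<exists>i<n. t < x i)"
proof -
  let ?l = "sort (map x [0..<n])"
  have "t < ?l ! (n - 1) \<longleftrightarrow> (\<exists>y\<in>set ?l. t < y)"
  proof
    assume "\<exists>y\<in>set ?l. t < y"
    then obtain j where "j < n" "t < ?l ! j"
      by (metis in_set_conv_nth length_map length_sort length_upt diff_zero)
    then show "t < ?l ! (n - 1)"
      using sorted_nth_mono[of ?l j "n - 1"] assms by (simp, linarith)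
  qed (use assms nth_mem[of "n - 1" ?l] in auto)
  also have "\<dots> \<longleftrightarrow> (\<exists>i<n. t < x i)" by auto
  finally show ?thesis by (simp add: order_statistic_def)
qed

text \<open>Both sets express that some sample point is at most \<open>t\<close> and another exceeds
  \<open>t\<close>.\<close>

lemma sample_range_eq:
  assumes "n > 0"
  shows "{order_statistic x n 1..<order_statistic x n n}
    = {t. 0 < empirical_df x n t \<and> empirical_df x n t < 1}"
  using assms
  by (auto simp only: atLeastLessThan_iff mem_Collect_eq order_statistic_first_le_iff
      less_order_statistic_last_iff empirical_df_pos_iff empirical_df_less_1_iff)

section \<open>Which points determine the limiting supremum\<close>

lemma unit_distribution_function_bounds:
  assumes "unit_distribution_function F"
  shows "0 \<le> F t" "F t \<le> 1"
proof -
  have mono: "mono F" and z: "\<And>x. x < 0 \<Longrightarrow> F x = 0" and o: "\<And>x. x \<ge> 1 \<Longrightarrow> F x = 1"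
    using assms by (auto simp: unit_distribution_function_def)
  have "F (min t (-1)) \<le> F t" "F t \<le> F (max t 1)" by (auto intro!: monoD[OF mono])
  then show "0 \<le> F t" "F t \<le> 1" using z[of "min t (-1)"] o[of "max t 1"] by auto
qed

text \<open>The point \<open>t = 0\<close> is outside the supremum defining \<open>S_inf\<close> but
  belongs to the sample range when a nonconstant sample has minimum 0. Right continuity of
  \<open>F\<close> makes its value a limit of values at points of \<open>(0,1)\<close>.\<close>

lemma K_le_S_inf:
  assumes F: "unit_distribution_function F" and s: "0 < s" "s < 1" and t: "0 \<le> t" "t < 1"
  shows "K s (F t) t \<le> S_inf s F"
proof -
  have bdd: "bdd_above ((\<lambda>x. K s (F x) x) ` {0<..<1})"
    by (rule bdd_aboveI2) (rule K_le[OF s])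
  have inner: "K s (F t) t \<le> S_inf s F" if "0 < t" "t < 1" for t
    unfolding S_inf_def using that by (intro cSUP_upper bdd) auto
  show ?thesis
  proof (cases "t = 0")
    case True
    have ev: "\<forall>\<^sub>F x in at_right (0::real). 0 < x \<and> x < 1"
      by (rule eventually_at_rightI[of 0 1]) auto
    have "continuous (at_right 0) F" using F by (simp add: unit_distribution_function_def)
    then have "(F \<longlongrightarrow> F 0) (at_right 0)" by (simp add: continuous_within)
    then have "((\<lambda>x. K s (F x) x) \<longlongrightarrow> K s (F 0) 0) (at_right 0)"
      by (intro tendsto_K s tendsto_ident_at)
         (use ev unit_distribution_function_bounds[OF F] in \<open>auto elim!: eventually_mono\<close>)
    then have "K s (F 0) 0 \<le> S_inf s F"
      by (rule tendsto_upperbound) (use ev inner in \<open>auto elim!: eventually_mono\<close>)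
    then show ?thesis using True by simp
  qed (use t inner in auto)
qed

text \<open>On an interval where \<open>F\<close> is constantly 0 or 1 the divergence is monotone in its second
  argument, so its supremum there is attained at the endpoint of the support, which continuity
  of \<open>F\<close> makes accessible from within.\<close>

lemma S_inf_approx_inner:
  assumes F: "unit_distribution_function F" and atom: "no_atom_at_inner_endpoints F"
    and s: "0 < s" "s < 1" and c: "c < S_inf s F"
  obtains t where "0 < F t" "F t < 1" "c < K s (F t) t"
proof -
  note bounds = unit_distribution_function_bounds[OF F]
  have mono: "\<And>x y. x \<le> y \<Longrightarrow> F x \<le> F y" and rc: "\<And>a. (F \<longlongrightarrow> F a) (at_right a)"
    and z: "\<And>x. x < 0 \<Longrightarrow> F x = 0" and o: "\<And>x. x \<ge> 1 \<Longrightarrow> F x = 1"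
    using F by (auto simp: unit_distribution_function_def mono_def continuous_within)
  obtain x where x: "0 < x" "x < 1" "c < K s (F x) x"
  proof -
    have "\<exists>x\<in>{0<..<1}. c < K s (F x) x"
      using c unfolding S_inf_def
      by (subst (asm) less_cSUP_iff) (auto intro!: bdd_aboveI2 K_le[OF s])
    then show thesis using that by auto
  qed
  consider "0 < F x" "F x < 1" | "F x = 0" | "F x = 1" using bounds[of x] by fastforce
  then show thesis
  proof cases
    case 1
    with x that show thesis by blast
  next
    case 2
    \<comment> \<open>The lower endpoint of the support; \<open>x \<le> a\<close> since
      \<open>F x = 0\<close>.\<close>
    define a where "a = Sup {y. F y = 0}"
    have bdd: "bdd_above {y. F y = 0}" using o
    by (intro bdd_aboveI[of _ 1]) (metis linear mem_Collect_eq zero_neq_one)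
    have xa: "x \<le> a" unfolding a_def using bdd 2 by (auto intro: cSup_upper)
    have below: "F y = 0" if "y < a" for y
    proof -
      have "{y. F y = 0} \<noteq> {}" using 2 by blast
      from less_cSupD[OF this that[unfolded a_def]] obtain w where "F w = 0" "y < w" by blast
      then show ?thesis using mono[of y w] bounds(1)[of y] by simp
    qed
    have above: "0 < F y" if "a < y" for y
      using that cSup_upper[OF _ bdd, of y] bounds(1)[of y] unfolding a_def by fastforce
    \<comment> \<open>Here \<open>a \<ge> x > 0\<close>, so the endpoint condition applies;
      comparing left limits then gives \<open>F a = 0\<close>.\<close>
    have "isCont F a" using atom below x xa unfolding no_atom_at_inner_endpoints_def by auto
    then have "(F \<longlongrightarrow> F a) (at_left a)"
      by (simp add: isCont_def filterlim_at_split)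
    moreover have "(F \<longlongrightarrow> 0) (at_left a)"
      by (rule tendsto_eventually) (use below in \<open>auto simp: eventually_at_filter\<close>)
    ultimately have Fa: "F a = 0" by (rule tendsto_unique[rotated]) simp
    then have a1: "a < 1" using o[of a] by force
    have ev: "\<forall>\<^sub>F t in at_right a. a < t \<and> t < 1"
      by (rule eventually_at_rightI[of a 1]) (use a1 in auto)
    have "((\<lambda>t. K s (F t) t) \<longlongrightarrow> K s (F a) a) (at_right a)"
      by (intro tendsto_K s tendsto_ident_at rc)
         (use ev bounds x xa a1 in \<open>auto elim!: eventually_mono\<close>)
    \<comment> \<open>Moving from \<open>x\<close> up to \<open>a\<close> can only increase the
      divergence while \<open>F\<close> is 0. Points slightly right of \<open>a\<close> then have
      \<open>F\<close> positive and still below 1.\<close>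
    moreover have "c < K s (F a) a" using K_0_mono[OF s xa] x 2 Fa a1 by simp
    ultimately have "\<forall>\<^sub>F t in at_right a. c < K s (F t) t" by (rule order_tendstoD)
    moreover have "\<forall>\<^sub>F t in at_right a. F t < 1" using rc by (rule order_tendstoD) (simp add: Fa)
    ultimately have "\<forall>\<^sub>F t in at_right a. c < K s (F t) t \<and> F t < 1 \<and> 0 < F t"
      using ev by eventually_elim (use above in auto)
    then obtain t where "c < K s (F t) t" "F t < 1" "0 < F t"
      using eventually_happens' trivial_limit_at_right_real by blast
    then show thesis using that by blast
  next
    case 3
    \<comment> \<open>The upper endpoint of the support. In contrast to \<open>a\<close>, right
      continuity alone yields \<open>F b = 1\<close>; the endpoint condition is what allows
      approaching \<open>b\<close> from the left, where \<open>F < 1\<close>.\<close>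
    define b where "b = Inf {y. F y = 1}"
    have bdd: "bdd_below {y. F y = 1}" using z
    by (intro bdd_belowI[of _ 0]) (metis leI mem_Collect_eq zero_neq_one)
    have xb: "b \<le> x" unfolding b_def using bdd 3 by (auto intro: cInf_lower)
    have above: "F y = 1" if "b < y" for y
    proof -
      have "{y. F y = 1} \<noteq> {}" using 3 by blast
      from cInf_lessD[OF this that[unfolded b_def]] obtain w where "F w = 1" "w < y" by blast
      then show ?thesis using mono[of w y] bounds(2)[of y] by simp
    qed
    have below: "F y < 1" if "y < b" for y
      using that cInf_lower[OF _ bdd, of y] bounds(2)[of y] unfolding b_def by fastforce
    have "(F \<longlongrightarrow> 1) (at_right b)"
      by (rule tendsto_eventually) (use above in \<open>auto simp: eventually_at_filter\<close>)
    then have Fb: "F b = 1" by (rule tendsto_unique[OF _ rc, rotated]) simp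
    have "isCont F b" using atom above x xb unfolding no_atom_at_inner_endpoints_def by auto
    then have lc: "(F \<longlongrightarrow> 1) (at_left b)"
      by (simp add: isCont_def filterlim_at_split Fb)
    then have pos: "\<forall>\<^sub>F t in at_left b. 0 < F t" by (rule order_tendstoD) simp
    \<comment> \<open>If \<open>b \<le> 0\<close>, then \<open>F\<close> would vanish left of
      \<open>b\<close>, contradicting its left limit 1.\<close>
    have b0: "0 < b"
    proof (rule ccontr)
      assume "\<not> 0 < b"
      then have "\<forall>\<^sub>F t in at_left b. F t = 0" using z by (auto simp: eventually_at_filter)
      with pos have "\<forall>\<^sub>F t in at_left b. False" by eventually_elim simp
      then show False by simp
    qed
    have ev: "\<forall>\<^sub>F t in at_left b. 0 < t \<and> t < b"
      by (rule eventually_at_leftI[of 0 b]) (use b0 in auto)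
    have "((\<lambda>t. K s (F t) t) \<longlongrightarrow> K s 1 b) (at_left b)"
      by (intro tendsto_K s tendsto_ident_at lc)
         (use ev bounds x xb b0 in \<open>auto elim!: eventually_mono\<close>)
    moreover have "c < K s 1 b" using K_1_antimono[OF s _ xb] x 3 b0 by simp
    ultimately have "\<forall>\<^sub>F t in at_left b. c < K s (F t) t" by (rule order_tendstoD)
    then have "\<forall>\<^sub>F t in at_left b. c < K s (F t) t \<and> F t < 1 \<and> 0 < F t"
      using ev pos by eventually_elim (use below in auto)
    then obtain t where "c < K s (F t) t" "F t < 1" "0 < F t"
      using eventually_happens' trivial_limit_at_left_real by blast
    then show thesis using that by blast
  qed
qed

section \<open>Convergence of the statistic\<close>

text \<open>Uniform closeness of the divergences bounds \<open>S_n\<close> above by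
  \<open>S_inf + e / 2\<close>. For the lower bound, a single \<open>t\<close> with
  \<open>0 < F t < 1\<close> and divergence above \<open>S_inf - e / 2\<close> is fixed; it
  eventually lies in the sample range, and replacing \<open>F\<close> by the empirical distribution
  function costs another \<open>e / 2\<close>.\<close>

lemma S_n_tendsto_S_inf:
  assumes F: "unit_distribution_function F" and atom: "no_atom_at_inner_endpoints F"
    and s: "0 < s" "s < 1"
    and x: "\<And>i. 0 \<le> x i" "\<And>i. x i \<le> 1"
    and unif: "uniform_limit UNIV (empirical_df x) F sequentially"
  shows "S_n s x \<longlonglongrightarrow> S_inf s F"
proof (rule tendstoI)
  note bounds = unit_distribution_function_bounds[OF F]
  fix e :: real assume e: "e > 0"
  have "uniformly_continuous_on ({0..1} \<times> {0..1}) (\<lambda>z. K s (fst z) (snd z))"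
    by (intro compact_uniformly_continuous continuous_on_K s compact_Times) auto
  then obtain d where d: "d > 0"
    and uc: "\<And>y z. y \<in> {0..1} \<times> {0..1} \<Longrightarrow> z \<in> {0..1} \<times> {0..1} \<Longrightarrow> dist y z < d \<Longrightarrow>
      dist (K s (fst y) (snd y)) (K s (fst z) (snd z)) < e / 2"
    using e unfolding uniformly_continuous_on_def by (metis half_gt_zero)
  have close: "\<bar>K s u v - K s w v\<bar> < e / 2"
    if "u \<in> {0..1}" "w \<in> {0..1}" "v \<in> {0..1}" "dist u w < d" for u w v
    using uc[of "(u, v)" "(w, v)"] that by (simp add: dist_real_def dist_Pair_Pair)
  obtain t where t: "0 < F t" "F t < 1" "S_inf s F - e / 2 < K s (F t) t"
    using S_inf_approx_inner[OF F atom s, of "S_inf s F - e / 2"] e by auto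
  have t01: "t \<in> {0..1}"
    using t(1,2) F unfolding unit_distribution_function_def atLeastAtMost_iff
    by (metis leI less_irrefl linear)
  have lim: "(\<lambda>n. empirical_df x n t) \<longlonglongrightarrow> F t" using unif by (rule tendsto_uniform_limitI) simp
  have "\<forall>\<^sub>F n in sequentially. 0 < empirical_df x n t" "\<forall>\<^sub>F n in sequentially. empirical_df x n t < 1"
    using lim t by (auto intro: order_tendstoD)
  moreover have "\<forall>\<^sub>F n in sequentially. \<forall>t\<in>UNIV. dist (empirical_df x n t) (F t) < d"
    using unif d by (rule uniform_limitD)
  moreover have "\<forall>\<^sub>F n::nat in sequentially. n > 0" by (rule eventually_gt_at_top)
  ultimately show "\<forall>\<^sub>F n in sequentially. dist (S_n s x n) (S_inf s F) < e"
  proof eventually_elim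
    case (elim n)
    let ?T = "{order_statistic x n 1..<order_statistic x n n}"
    have T: "u \<in> ?T \<longleftrightarrow> 0 < empirical_df x n u \<and> empirical_df x n u < 1" for u
      unfolding sample_range_eq[OF elim(4)] by simp
    have K_close: "\<bar>K s (empirical_df x n u) u - K s (F u) u\<bar> < e / 2" if "u \<in> {0..1}" for u
      using that elim(3) bounds empirical_df_nonneg empirical_df_le_1 by (intro close) auto
    have "S_n s x n \<le> S_inf s F + e / 2"
      unfolding S_n_def
    proof (rule cSUP_least)
      \<comment> \<open>The fixed \<open>t\<close> is a member, so \<open>S_n\<close> is a genuine
        supremum here and not the unspecified value.\<close>
      show "?T \<noteq> {}" using T elim by blast
      fix u assume "u \<in> ?T"
      then obtain i j where "x i \<le> u" "u < x j"
        using T[of u] empirical_df_pos_iff[OF elim(4)] empirical_df_less_1_iff[OF elim(4)] by blast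
      \<comment> \<open>The lower bound is not strict: \<open>u = 0\<close> occurs if a sample point
        is 0.\<close>
      then have u: "0 \<le> u" "u < 1" using x[of i] x[of j] by auto
      then show "K s (empirical_df x n u) u \<le> S_inf s F + e / 2"
        using K_close[of u] K_le_S_inf[OF F s u] unfolding atLeastAtMost_iff by linarith
    qed
    moreover have "K s (empirical_df x n t) t \<le> S_n s x n"
      unfolding S_n_def
      by (rule cSUP_upper) (use T elim K_le[OF s] in \<open>auto intro!: bdd_aboveI2\<close>)
    ultimately show ?case using K_close[OF t01] t(3) e unfolding dist_real_def by linarith
  qed
qed

text \<open>Since 0 may carry an atom, the cdf vanishes for certain only at negative arguments; the
  event that \<open>X\<close> is negative is therefore exhausted by the null events
  \<open>X \<le> - 1 / (k + 1)\<close>.\<close>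

lemma (in prob_space) AE_mem_unit_interval:
  assumes X: "random_variable borel X" and F: "unit_distribution_function (cdf (distr M borel X))"
  shows "AE \<omega> in M. 0 \<le> X \<omega> \<and> X \<omega> \<le> 1"
proof -
  note [measurable] = X
  have cdf: "cdf (distr M borel X) t = \<P>(\<omega> in M. X \<omega> \<le> t)" for t
    by (simp add: cdf_def measure_distr vimage_def Int_def conj_commute)
  have "\<P>(\<omega> in M. X \<omega> \<le> 1) = 1"
    using F cdf[of 1] by (simp add: unit_distribution_function_def)
  then have "AE \<omega> in M. X \<omega> \<le> 1" by (subst (asm) prob_Collect_eq_1) simp_all
  moreover have "AE \<omega> in M. \<not> X \<omega> \<le> - inverse (real (Suc k))" for k
  proof -
    have "\<P>(\<omega> in M. X \<omega> \<le> - inverse (real (Suc k))) = 0"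
      using F cdf[of "- inverse (real (Suc k))"] by (simp add: unit_distribution_function_def)
    then show ?thesis by (subst (asm) prob_Collect_eq_0) simp_all
  qed
  then have "AE \<omega> in M. \<forall>k. \<not> X \<omega> \<le> - inverse (real (Suc k))"
    by (subst AE_all_countable) simp
  ultimately show ?thesis
  proof eventually_elim
    case (elim \<omega>)
    then show ?case using reals_Archimedean[of "- X \<omega>"] by (smt (verit))
  qed
qed

theorem proposition4p1:
  fixes M :: "'a measure" and X :: "nat \<Rightarrow> 'a \<Rightarrow> real"
    and F :: "real \<Rightarrow> real" and s :: real
  assumes "prob_space M"
    and "unit_distribution_function F"
    and "no_atom_at_inner_endpoints F"
    and "prob_space.indep_vars M (\<lambda>_. borel) X UNIV"
    and "\<And>i. cdf (distr M borel (X i)) = F"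
    and "0 < s" and "s < 1"
  shows "AE \<omega> in M. (\<lambda>n. S_n s (\<lambda>i. X i \<omega>) n) \<longlonglongrightarrow> S_inf s F"
proof -
  interpret prob_space M by fact
  have "random_variable borel (X i)" for i
    using assms(4) unfolding indep_vars_def by blast
  then have "AE \<omega> in M. 0 \<le> X i \<omega> \<and> X i \<omega> \<le> 1" for i
    by (rule AE_mem_unit_interval) (simp add: assms)
  then have "AE \<omega> in M. \<forall>i. 0 \<le> X i \<omega> \<and> X i \<omega> \<le> 1"
    by (subst AE_all_countable) simp
  with Glivenko_Cantelli[OF assms(4,5)] show ?thesis
    by eventually_elim (rule S_n_tendsto_S_inf, use assms in auto)
qed

end
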